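(* In the channel setting of the context, suppose the input efficient influence $\nabla\beta\in\mathcal T(f)$ exists. Let $F_{\mathrm{push}}:\mathcal T(f)\to\mathcal A(g)$ be the channel pushforward and $F^{\mathrm{pull}}=F_{\mathrm{push}}^\dagger:\mathcal A(g)\to\mathcal T(f)$ the channel pullback. If $\nabla\beta\notin\operatorname{range}F^{\mathrm{pull}}$, then $\operatorname{Bnd}_{\mathrm{out}}=\infty$. Otherwise, if $\nabla\beta\in\operatorname{range}F^{\mathrm{pull}}$, then the output efficient influence $\nabla_{\mathrm{out}}\beta\in\mathcal T(g)$ exists and is $$\nabla_{\mathrm{out}}\beta=F^{\mathrm{pull}\,-}\,\nabla\beta ,$$ where $F^{\mathrm{pull}\,-}$ is the pseudo-inverse of $F^{\mathrm{pull}}$, and the output efficiency bound is $$\operatorname{Bnd}_{\mathrm{out}}=\|\nabla_{\mathrm{out}}\beta\|_g^2=\|F^{\mathrm{pull}\,-}\nabla\beta\|_g^2 .$$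
   Context: Input. $\mathcal T_\theta$ is a real vector space (tangent vectors $\dot\phi$ at a fixed parameter $\theta$) and $d\beta:\mathcal T_\theta\to\mathbb R$ a linear functional. $\mathcal V$ is a real vector space with semi-inner product $\langle\cdot,\cdot\rangle_f$ and seminorm $\|\cdot\|_f$; $\operatorname{score}:\mathcal T_\theta\to\mathcal V$ is linear; $\mathcal N(f)=\{A\in\mathcal V:\|A\|_f=0\}$; $\mathcal A(f)$ is the Hilbert-space completion of $\mathcal V/\mathcal N(f)$; $f_{\mathrm{push}}:\mathcal T_\theta\to\mathcal A(f)$, $f_{\mathrm{push}}\dot\phi=\operatorname{score}(\dot\phi)+\mathcal N(f)$; $\mathcal T(f)=\overline{\operatorname{range}f_{\mathrm{push}}}\subseteq\mathcal A(f)$. The input efficient influence, when it exists, is the unique $\nabla\beta\in\mathcal T(f)$ with $d\beta(\dot\phi)=\langle\nabla\beta,f_{\mathrm{push}}\dot\phi\rangle_f$ for all $\dot\phi\in\mathcal T_\theta$. Output. Similarly $\mathcal V_{\mathrm{out}}$, $\langle\cdot,\cdot\rangle_g$, $\operatorname{score}_{\mathrm{out}}:\mathcal T_\theta\to\mathcal V_{\mathrm{out}}$, $\mathcal N(g)$, $\mathcal A(g)$, $g_{\mathrm{push}}:\mathcal T_\theta\to\mathcal A(g)$, $\mathcal T(g)=\overline{\operatorname{range}g_{\mathrm{push}}}$ are defined in the same way for the output. The output efficient influence, when it exists, is the unique $\nabla_{\mathrm{out}}\beta\in\mathcal T(g)$ with $d\beta(\dot\phi)=\langle\nabla_{\mathrm{out}}\beta,g_{\mathrm{push}}\dot\phi\rangle_g$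 for all $\dot\phi$. The output efficiency bound is $\operatorname{Bnd}_{\mathrm{out}}=\sup_{\dot\phi:\,g_{\mathrm{push}}\dot\phi\ne0}[d\beta(\dot\phi)]^2/\|g_{\mathrm{push}}\dot\phi\|_g^2$ (with $\sup\emptyset=0$) if $d\beta$ vanishes on $\ker g_{\mathrm{push}}$, and $\operatorname{Bnd}_{\mathrm{out}}=\infty$ otherwise. Channel. The channel is such that there is a linear map $F_{\mathrm{push}}:\operatorname{range}f_{\mathrm{push}}\to\mathcal A(g)$ with $g_{\mathrm{push}}=F_{\mathrm{push}}f_{\mathrm{push}}$, assumed bounded, and extended uniquely by continuity to a bounded map $F_{\mathrm{push}}:\mathcal T(f)\to\mathcal A(g)$. $\dagger$ denotes the Hilbert-space adjoint. Pseudo-inverse. For a bounded linear map $T:H_1\to H_2$ of Hilbert spaces, $T^-:\operatorname{range}T\oplus(\operatorname{range}T)^\perp\to H_1$ is the (possibly unbounded) linear map with $\ker T^-=(\operatorname{range}T)^\perp$ and, for $y\in\operatorname{range}T$, $T^-y$ equal to the unique solution $x$ of $Tx=y$ of minimum norm (equivalently, the unique solution in $(\ker T)^\perp$). *)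

theory Defs
  imports "HOL-Analysis.Analysis"
begin

section \<open>Semi-inner product spaces and the quotient by the null space\<close>

class real_semi_inner = real_vector +
  fixes semi_inner :: "'a \<Rightarrow> 'a \<Rightarrow> real"
  assumes semi_inner_commute: "semi_inner x y = semi_inner y x"
    and semi_inner_add_left: "semi_inner (x + y) z = semi_inner x z + semi_inner y z"
    and semi_inner_scaleR_left: "semi_inner (r *\<^sub>R x) y = r * semi_inner x y"
    and semi_inner_ge_zero: "0 \<le> semi_inner x x"

definition seminorm :: "'a::real_semi_inner \<Rightarrow> real"
  where "seminorm x = sqrt (semi_inner x x)"

definition null_space :: "'a::real_semi_inner set"
  where "null_space = {x. seminorm x = 0}"

lemma semi_inner_add_right: "semi_inner x (y + z) = semi_inner x y + semi_inner x z"
  by (metis semi_inner_commute semi_inner_add_left)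

lemma semi_inner_scaleR_right: "semi_inner x (r *\<^sub>R y) = r * semi_inner x y"
  by (metis semi_inner_commute semi_inner_scaleR_left)

lemma semi_inner_minus_left: "semi_inner (- x) y = - semi_inner x y"
  using semi_inner_scaleR_left[of "-1" x y] by simp

lemma semi_inner_minus_right: "semi_inner x (- y) = - semi_inner x y"
  by (metis semi_inner_commute semi_inner_minus_left)

lemma semi_inner_diff_left: "semi_inner (x - y) z = semi_inner x z - semi_inner y z"
  by (metis diff_conv_add_uminus semi_inner_add_left semi_inner_minus_left)

lemma mem_null_space_iff: "x \<in> null_space \<longleftrightarrow> semi_inner x x = 0"
  by (simp add: null_space_def seminorm_def)

lemma semi_inner_null_left:
  fixes x y :: "'a::real_semi_inner"
  assumes "x \<in> null_space"
  shows "semi_inner x y = 0"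
proof (rule ccontr)
  assume nz: "semi_inner x y \<noteq> 0"
  define t where "t = - (semi_inner y y + 1) / (2 * semi_inner x y)"
  have "0 \<le> semi_inner (t *\<^sub>R x + y) (t *\<^sub>R x + y)"
    by (rule semi_inner_ge_zero)
  also have "\<dots> = 2 * t * semi_inner x y + semi_inner y y"
    using assms by (simp add: mem_null_space_iff semi_inner_add_left semi_inner_add_right
        semi_inner_scaleR_left semi_inner_scaleR_right semi_inner_commute[of y x])
  also have "\<dots> = -1"
    using nz by (simp add: t_def field_simps)
  finally show False by simp
qed

lemma semi_inner_null_right: "y \<in> null_space \<Longrightarrow> semi_inner x y = 0"
  by (metis semi_inner_commute semi_inner_null_left)

lemma subspace_null_space: "subspace null_space"
proof (rule subspaceI)
  fix x y :: 'a and c :: real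
  show "0 \<in> (null_space :: 'a set)"
    using semi_inner_scaleR_left[of 0 0 "0::'a"] by (simp add: mem_null_space_iff)
  show "x + y \<in> null_space" if "x \<in> null_space" "y \<in> null_space"
    using that by (simp add: mem_null_space_iff[of "x + y"] semi_inner_add_left
        semi_inner_null_left)
  show "c *\<^sub>R x \<in> null_space" if "x \<in> null_space"
    using that by (simp add: mem_null_space_iff semi_inner_scaleR_left semi_inner_scaleR_right)
qed

quotient_type (overloaded) 'a null_quotient = "'a::real_semi_inner" / "\<lambda>x y. x - y \<in> null_space"
  morphisms rep_null_quotient null_class
proof (rule equivpI)
  show "reflp (\<lambda>x y::'a. x - y \<in> null_space)"
    by (rule reflpI) (simp add: subspace_0[OF subspace_null_space])
  show "symp (\<lambda>x y::'a. x - y \<in> null_space)"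
    by (rule sympI) (metis minus_diff_eq subspace_neg[OF subspace_null_space])
  show "transp (\<lambda>x y::'a. x - y \<in> null_space)"
    by (rule transpI) (metis diff_add_cancel add_diff_eq subspace_add[OF subspace_null_space])
qed

instantiation null_quotient :: (real_semi_inner) real_inner
begin

lift_definition zero_null_quotient :: "'a null_quotient" is 0 .

lift_definition plus_null_quotient :: "'a null_quotient \<Rightarrow> 'a null_quotient \<Rightarrow> 'a null_quotient"
  is "(+)"
  by (metis add_diff_add subspace_add[OF subspace_null_space])

lift_definition uminus_null_quotient :: "'a null_quotient \<Rightarrow> 'a null_quotient"
  is "uminus"
  by (metis minus_diff_minus subspace_neg[OF subspace_null_space])

lift_definition scaleR_null_quotient :: "real \<Rightarrow> 'a null_quotient \<Rightarrow> 'a null_quotient"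
  is "scaleR"
  by (metis scaleR_right_diff_distrib subspace_scale[OF subspace_null_space])

lift_definition inner_null_quotient :: "'a null_quotient \<Rightarrow> 'a null_quotient \<Rightarrow> real"
  is "semi_inner"
proof -
  fix x x' y y' :: 'a
  assume "x - x' \<in> null_space" "y - y' \<in> null_space"
  then have "semi_inner (x - x') y = 0" "semi_inner (y - y') x' = 0"
    by (simp_all add: semi_inner_null_left)
  then show "semi_inner x y = semi_inner x' y'"
    by (simp add: semi_inner_diff_left semi_inner_commute[of x'])
qed

definition minus_null_quotient :: "'a null_quotient \<Rightarrow> 'a null_quotient \<Rightarrow> 'a null_quotient"
  where "minus_null_quotient a b = a + - b"

definition norm_null_quotient :: "'a null_quotient \<Rightarrow> real"
  where "norm_null_quotient a = sqrt (inner a a)"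

definition dist_null_quotient :: "'a null_quotient \<Rightarrow> 'a null_quotient \<Rightarrow> real"
  where "dist_null_quotient a b = norm (a - b)"

definition sgn_null_quotient :: "'a null_quotient \<Rightarrow> 'a null_quotient"
  where "sgn_null_quotient a = inverse (norm a) *\<^sub>R a"

definition uniformity_null_quotient :: "('a null_quotient \<times> 'a null_quotient) filter"
  where "uniformity_null_quotient = (INF e\<in>{0 <..}. principal {(x, y). dist x y < e})"

definition open_null_quotient :: "'a null_quotient set \<Rightarrow> bool"
  where "open_null_quotient S = (\<forall>x\<in>S. \<forall>\<^sub>F (x', y) in uniformity. x' = x \<longrightarrow> y \<in> S)"

instance
proof
  note z = subspace_0[OF subspace_null_space]
  fix a b c :: "'a null_quotient" and r s :: real
  show "a + b + c = a + (b + c)" by transfer (simp add: z algebra_simps)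
  show "a + b = b + a" by transfer (simp add: z algebra_simps)
  show "0 + a = a" by transfer (simp add: z)
  show "- a + a = 0" by transfer (simp add: z)
  show "a - b = a + - b" by (rule minus_null_quotient_def)
  show "r *\<^sub>R (a + b) = r *\<^sub>R a + r *\<^sub>R b" by transfer (simp add: z algebra_simps)
  show "(r + s) *\<^sub>R a = r *\<^sub>R a + s *\<^sub>R a" by transfer (simp add: z algebra_simps)
  show "r *\<^sub>R s *\<^sub>R a = (r * s) *\<^sub>R a" by transfer (simp add: z)
  show "1 *\<^sub>R a = a" by transfer (simp add: z)
  show "inner a b = inner b a" by transfer (rule semi_inner_commute)
  show "inner (a + b) c = inner a c + inner b c" by transfer (rule semi_inner_add_left)
  show "inner (r *\<^sub>R a) b = r * inner a b" by transfer (rule semi_inner_scaleR_left)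
  show "0 \<le> inner a a" by transfer (rule semi_inner_ge_zero)
  show "inner a a = 0 \<longleftrightarrow> a = 0" by transfer (simp add: mem_null_space_iff)
qed (simp_all add: norm_null_quotient_def dist_null_quotient_def sgn_null_quotient_def
      uniformity_null_quotient_def open_null_quotient_def)

end

lemma linear_null_class: "linear null_class"
  by (rule linearI) (simp_all add: plus_null_quotient.abs_eq scaleR_null_quotient.abs_eq)

lemma inner_null_class: "inner (null_class x) (null_class y) = semi_inner x y"
  by (simp add: inner_null_quotient.abs_eq)

lemma norm_null_class: "norm (null_class x) = seminorm x"
  by (simp add: norm_eq_sqrt_inner inner_null_class seminorm_def)

lemma null_class_eq_iff: "null_class x = null_class y \<longleftrightarrow> x - y \<in> null_space"
  by (rule null_quotient.abs_eq_iff)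


section \<open>Hilbert-space completion of an inner product space\<close>

text \<open>
  An inner product space embeds isometrically into its (Banach) dual by sending \<open>x\<close> to the
  functional \<open>\<langle>x, _\<rangle>\<close>; its completion is the closure of the image. The inner product of the
  completion is recovered from the norm by polarization. The lemmas \<open>linear_to_completion\<close>,
  \<open>inner_to_completion\<close> and \<open>closure_range_to_completion\<close> below, together with completeness of
  the type, determine the completion up to a unique isometric isomorphism.
\<close>

typedef (overloaded) 'a hilbert_completion =
  "closure (range (blinfun_inner_right :: 'a::real_inner \<Rightarrow> 'a \<Rightarrow>\<^sub>L real))"
  by (rule exI, rule subsetD[OF closure_subset], rule rangeI)

setup_lifting type_definition_hilbert_completion

lift_definition to_completion :: "'a::real_inner \<Rightarrow> 'a hilbert_completion"
  is blinfun_inner_right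
  by (rule subsetD[OF closure_subset], rule rangeI)

lemma norm_blinfun_inner_right: "norm (blinfun_inner_right x) = norm x"
proof (rule antisym)
  show "norm (blinfun_inner_right x) \<le> norm x"
    by (rule norm_blinfun_bound, rule norm_ge_zero)
      (simp only: blinfun_inner_right.rep_eq real_norm_def Cauchy_Schwarz_ineq2)
  have "norm x * norm x = x \<bullet> x"
    by (simp only: dot_square_norm power2_eq_square)
  also have "\<dots> \<le> norm (blinfun_apply (blinfun_inner_right x) x)"
    by (simp only: blinfun_inner_right.rep_eq real_norm_def abs_ge_self)
  also have "\<dots> \<le> norm (blinfun_inner_right x) * norm x"
    by (rule norm_blinfun)
  finally have *: "norm x * norm x \<le> norm (blinfun_inner_right x) * norm x" .
  show "norm x \<le> norm (blinfun_inner_right x)"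
  proof (cases "x = 0")
    case True
    then show ?thesis by (simp only: norm_zero norm_ge_zero)
  next
    case False
    then have "0 < norm x" by (simp only: zero_less_norm_iff not_False_eq_True)
    with * show ?thesis by (rule mult_right_le_imp_le)
  qed
qed

lemma linear_blinfun_inner_right: "linear blinfun_inner_right"
  by (rule bounded_linear.linear[OF bounded_linear_blinfun_inner_right])

lemma limit_in_closure: "(\<And>n::nat. X n \<in> S) \<Longrightarrow> X \<longlonglongrightarrow> l \<Longrightarrow> l \<in> closure S"
  for S :: "'a::first_countable_topology set"
  by (auto simp: closure_sequential)

lemma subspace_closure_blinfun_inner_right: "subspace (closure (range (blinfun_inner_right :: 'a::real_inner \<Rightarrow> _)))"
proof (rule subspaceI)
  let ?R = "range (blinfun_inner_right :: 'a \<Rightarrow> _)"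
  have R: "subspace ?R"
    by (rule linear_subspace_image[OF linear_blinfun_inner_right subspace_UNIV])
  show "0 \<in> closure ?R"
    by (rule subsetD[OF closure_subset subspace_0[OF R]])
  fix u v and c :: real
  assume "u \<in> closure ?R"
  then obtain U where U: "\<And>n. U n \<in> ?R" "U \<longlonglongrightarrow> u"
    unfolding closure_sequential by blast
  have "(\<lambda>n. c *\<^sub>R U n) \<longlonglongrightarrow> c *\<^sub>R u"
    by (intro tendsto_intros U)
  then show "c *\<^sub>R u \<in> closure ?R"
    by (rule limit_in_closure[OF subspace_scale[OF R U(1)]])
  assume "v \<in> closure ?R"
  then obtain V where V: "\<And>n. V n \<in> ?R" "V \<longlonglongrightarrow> v"
    unfolding closure_sequential by blast
  have "(\<lambda>n. U n + V n) \<longlonglongrightarrow> u + v"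
    by (intro tendsto_intros U V)
  then show "u + v \<in> closure ?R"
    by (rule limit_in_closure[OF subspace_add[OF R U(1) V(1)]])
qed

definition polar :: "'a::real_normed_vector \<Rightarrow> 'a \<Rightarrow> real"
  where "polar u v = ((norm (u + v))\<^sup>2 - (norm (u - v))\<^sup>2) / 4"

lemma continuous_on_polar [continuous_intros]:
  "continuous_on S f \<Longrightarrow> continuous_on S g \<Longrightarrow> continuous_on S (\<lambda>x. polar (f x) (g x))"
  unfolding polar_def by (intro continuous_intros) auto

lemma polar_inner: "polar x y = inner x y" for x y :: "'a::real_inner"
  by (simp add: polar_def power2_norm_eq_inner algebra_simps inner_commute)

lemma polar_blinfun_inner_right:
  "polar (blinfun_inner_right x) (blinfun_inner_right y) = inner x y"
  by (simp only: polar_inner[symmetric] polar_def norm_blinfun_inner_right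
      linear_add[OF linear_blinfun_inner_right, symmetric]
      linear_diff[OF linear_blinfun_inner_right, symmetric])

lemma polar_add_closure:
  assumes "u \<in> closure (range blinfun_inner_right)" "v \<in> closure (range blinfun_inner_right)"
    "w \<in> closure (range (blinfun_inner_right :: 'a::real_inner \<Rightarrow> _))"
  shows "polar (u + v) w = polar u w + polar v w"
proof -
  let ?R = "range (blinfun_inner_right :: 'a \<Rightarrow> _)"
  have "closure (?R \<times> ?R \<times> ?R) \<subseteq>
      {p. polar (fst p + fst (snd p)) (snd (snd p))
        = polar (fst p) (snd (snd p)) + polar (fst (snd p)) (snd (snd p))}"
  proof (rule closure_minimal)
    show "closed {p :: ('a \<Rightarrow>\<^sub>L real) \<times> ('a \<Rightarrow>\<^sub>L real) \<times> ('a \<Rightarrow>\<^sub>L real).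
        polar (fst p + fst (snd p)) (snd (snd p))
        = polar (fst p) (snd (snd p)) + polar (fst (snd p)) (snd (snd p))}"
      by (intro closed_Collect_eq continuous_intros)
    show "?R \<times> ?R \<times> ?R \<subseteq> {p. polar (fst p + fst (snd p)) (snd (snd p))
        = polar (fst p) (snd (snd p)) + polar (fst (snd p)) (snd (snd p))}"
      by (clarify, simp only: mem_Collect_eq fst_conv snd_conv polar_blinfun_inner_right
          inner_add_left linear_add[OF linear_blinfun_inner_right, symmetric])
  qed
  moreover have "(u, v, w) \<in> closure (?R \<times> ?R \<times> ?R)"
    using assms by (simp add: closure_Times)
  ultimately show ?thesis by auto
qed

lemma polar_scaleR_closure:
  assumes "u \<in> closure (range blinfun_inner_right)"
    "w \<in> closure (range (blinfun_inner_right :: 'a::real_inner \<Rightarrow> _))"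
  shows "polar (r *\<^sub>R u) w = r * polar u w"
proof -
  let ?R = "range (blinfun_inner_right :: 'a \<Rightarrow> _)"
  have "closure (?R \<times> ?R) \<subseteq> {p. polar (r *\<^sub>R fst p) (snd p) = r * polar (fst p) (snd p)}"
  proof (rule closure_minimal)
    show "closed {p :: ('a \<Rightarrow>\<^sub>L real) \<times> ('a \<Rightarrow>\<^sub>L real).
        polar (r *\<^sub>R fst p) (snd p) = r * polar (fst p) (snd p)}"
      by (intro closed_Collect_eq continuous_intros)
    show "?R \<times> ?R \<subseteq> {p. polar (r *\<^sub>R fst p) (snd p) = r * polar (fst p) (snd p)}"
      by (clarify, simp only: mem_Collect_eq fst_conv snd_conv polar_blinfun_inner_right
          inner_scaleR_left linear_scale[OF linear_blinfun_inner_right, symmetric])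
  qed
  moreover have "(u, w) \<in> closure (?R \<times> ?R)"
    using assms by (simp add: closure_Times)
  ultimately show ?thesis by auto
qed

instantiation hilbert_completion :: (real_inner) real_inner
begin

lift_definition zero_hilbert_completion :: "'a hilbert_completion" is 0
  by (rule subspace_0[OF subspace_closure_blinfun_inner_right])

lift_definition plus_hilbert_completion ::
  "'a hilbert_completion \<Rightarrow> 'a hilbert_completion \<Rightarrow> 'a hilbert_completion" is "(+)"
  by (rule subspace_add[OF subspace_closure_blinfun_inner_right])

lift_definition minus_hilbert_completion ::
  "'a hilbert_completion \<Rightarrow> 'a hilbert_completion \<Rightarrow> 'a hilbert_completion" is "(-)"
  by (rule subspace_diff[OF subspace_closure_blinfun_inner_right])

lift_definition uminus_hilbert_completion :: "'a hilbert_completion \<Rightarrow> 'a hilbert_completion"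
  is uminus
  by (rule subspace_neg[OF subspace_closure_blinfun_inner_right])

lift_definition scaleR_hilbert_completion ::
  "real \<Rightarrow> 'a hilbert_completion \<Rightarrow> 'a hilbert_completion" is scaleR
  by (rule subspace_scale[OF subspace_closure_blinfun_inner_right])

lift_definition norm_hilbert_completion :: "'a hilbert_completion \<Rightarrow> real" is norm .

lift_definition inner_hilbert_completion ::
  "'a hilbert_completion \<Rightarrow> 'a hilbert_completion \<Rightarrow> real" is polar .

definition dist_hilbert_completion :: "'a hilbert_completion \<Rightarrow> 'a hilbert_completion \<Rightarrow> real"
  where "dist_hilbert_completion a b = norm (a - b)"

definition sgn_hilbert_completion :: "'a hilbert_completion \<Rightarrow> 'a hilbert_completion"
  where "sgn_hilbert_completion a = inverse (norm a) *\<^sub>R a"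

definition uniformity_hilbert_completion ::
  "('a hilbert_completion \<times> 'a hilbert_completion) filter"
  where "uniformity_hilbert_completion = (INF e\<in>{0 <..}. principal {(x, y). dist x y < e})"

definition open_hilbert_completion :: "'a hilbert_completion set \<Rightarrow> bool"
  where "open_hilbert_completion S = (\<forall>x\<in>S. \<forall>\<^sub>F (x', y) in uniformity. x' = x \<longrightarrow> y \<in> S)"

instance
proof
  fix a b c :: "'a hilbert_completion" and r s :: real
  have polar_self: "polar u u = (norm u)\<^sup>2" for u :: "'a \<Rightarrow>\<^sub>L real"
    by (simp add: polar_def scaleR_2[symmetric] power_mult_distrib)
  show "a + b + c = a + (b + c)" by transfer simp
  show "a + b = b + a" by transfer simp
  show "0 + a = a" by transfer simp
  show "- a + a = 0" by transfer simp
  show "a - b = a + - b" by transfer simp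
  show "r *\<^sub>R (a + b) = r *\<^sub>R a + r *\<^sub>R b" by transfer (simp add: scaleR_add_right)
  show "(r + s) *\<^sub>R a = r *\<^sub>R a + s *\<^sub>R a" by transfer (simp add: scaleR_add_left)
  show "r *\<^sub>R s *\<^sub>R a = (r * s) *\<^sub>R a" by transfer simp
  show "1 *\<^sub>R a = a" by transfer simp
  show "inner a b = inner b a" by transfer (simp add: polar_def add.commute norm_minus_commute)
  show "inner (a + b) c = inner a c + inner b c" by transfer (rule polar_add_closure)
  show "inner (r *\<^sub>R a) b = r * inner a b" by transfer (rule polar_scaleR_closure)
  show "0 \<le> inner a a" by transfer (simp add: polar_self)
  show "inner a a = 0 \<longleftrightarrow> a = 0" by transfer (simp add: polar_self)
  show "norm a = sqrt (inner a a)" by transfer (simp add: polar_self)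
qed (simp_all add: dist_hilbert_completion_def sgn_hilbert_completion_def
      uniformity_hilbert_completion_def open_hilbert_completion_def)

end

lemma linear_to_completion: "linear to_completion"
  by (rule linearI; transfer)
    (simp_all add: linear_add[OF linear_blinfun_inner_right]
      linear_scale[OF linear_blinfun_inner_right])

lemma inner_to_completion: "inner (to_completion x) (to_completion y) = inner x y"
  by transfer (rule polar_blinfun_inner_right)

lemma dist_hilbert_completion_rep:
  "dist a b = dist (Rep_hilbert_completion a) (Rep_hilbert_completion b)"
  by (simp add: dist_norm norm_hilbert_completion.rep_eq minus_hilbert_completion.rep_eq)

lemma closure_range_to_completion: "closure (range to_completion) = UNIV"
proof -
  have "a \<in> closure (range to_completion)" for a :: "'a hilbert_completion"
  proof -
    have "Rep_hilbert_completion a \<in> closure (range blinfun_inner_right)"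
      by (rule Rep_hilbert_completion)
    then show ?thesis
      unfolding closure_approachable
      by (simp add: dist_hilbert_completion_rep to_completion.rep_eq)
  qed
  then show ?thesis by auto
qed

instance hilbert_completion :: (real_inner) banach
proof
  fix X :: "nat \<Rightarrow> 'a hilbert_completion"
  assume "Cauchy X"
  then have "Cauchy (\<lambda>n. Rep_hilbert_completion (X n))"
    by (simp add: Cauchy_def dist_hilbert_completion_rep)
  then obtain l where l: "(\<lambda>n. Rep_hilbert_completion (X n)) \<longlonglongrightarrow> l"
    by (auto simp: Cauchy_convergent_iff convergent_def)
  have "l \<in> closure (range blinfun_inner_right)"
    by (rule closed_sequentially[OF closed_closure _ l]) (rule Rep_hilbert_completion)
  then have "Rep_hilbert_completion (Abs_hilbert_completion l) = l"
    by (rule Abs_hilbert_completion_inverse)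
  then have "X \<longlonglongrightarrow> Abs_hilbert_completion l"
    using l by (simp add: tendsto_dist_iff[of X] tendsto_dist_iff[of "\<lambda>n. Rep_hilbert_completion (X n)"]
        dist_hilbert_completion_rep)
  then show "convergent X"
    by (rule convergentI)
qed

text \<open>The space \<open>\<A>(f)\<close> of the semi-inner product space \<open>\<V> = 'v\<close> is \<open>'v ambient\<close>.\<close>

type_synonym 'v ambient = "'v null_quotient hilbert_completion"


section \<open>Operators between closed subspaces\<close>

text \<open>
  The Hilbert spaces \<open>H\<close>, \<open>H\<^sub>1\<close>, \<open>H\<^sub>2\<close> below are closed subspaces of Hilbert-space types, and an
  operator on such a space is a function whose values outside the space are irrelevant.
\<close>

definition bounded_linear_on ::
  "'a::real_normed_vector set \<Rightarrow> ('a \<Rightarrow> 'b::real_normed_vector) \<Rightarrow> bool"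
  where "bounded_linear_on S T \<longleftrightarrow>
    (\<forall>x\<in>S. \<forall>y\<in>S. T (x + y) = T x + T y) \<and>
    (\<forall>c. \<forall>x\<in>S. T (c *\<^sub>R x) = c *\<^sub>R T x) \<and>
    (\<exists>K. \<forall>x\<in>S. norm (T x) \<le> K * norm x)"

definition adjoint_on :: "'a::real_inner set \<Rightarrow> ('a \<Rightarrow> 'b::real_inner) \<Rightarrow> 'b \<Rightarrow> 'a"
  where "adjoint_on H T y = (THE x. x \<in> H \<and> (\<forall>u\<in>H. x \<bullet> u = y \<bullet> T u))"

definition is_min_norm_solution ::
  "'a::real_inner set \<Rightarrow> ('a \<Rightarrow> 'b::real_inner) \<Rightarrow> 'b \<Rightarrow> 'a \<Rightarrow> bool"
  where "is_min_norm_solution H T y x \<longleftrightarrow>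
    x \<in> H \<and> T x = y \<and> (\<forall>x'\<in>H. T x' = y \<longrightarrow> norm x \<le> norm x')"

text \<open>
  For \<open>z = y + w\<close> with \<open>y\<close> in the range and \<open>w\<close> orthogonal to it, the value is the
  minimum-norm solution of \<open>T x = y\<close>; in particular the kernel is the orthogonal complement of
  the range. The value is unspecified at points which do not have such a decomposition.
\<close>

definition pseudo_inverse ::
  "'a::real_inner set \<Rightarrow> 'b set \<Rightarrow> ('a \<Rightarrow> 'b::real_inner) \<Rightarrow> 'b \<Rightarrow> 'a"
  where "pseudo_inverse H\<^sub>1 H\<^sub>2 T z =
    (THE x. \<exists>y\<in>T ` H\<^sub>1. \<exists>w\<in>H\<^sub>2 \<inter> (T ` H\<^sub>1)\<^sup>\<bottom>. z = y + w \<and> is_min_norm_solution H\<^sub>1 T y x)"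


section \<open>Efficient influences and efficiency bounds\<close>

definition push :: "('t \<Rightarrow> 'v::real_semi_inner) \<Rightarrow> 't \<Rightarrow> 'v ambient"
  where "push score \<phi> = to_completion (null_class (score \<phi>))"

definition tangent_space :: "('t \<Rightarrow> 'v::real_semi_inner) \<Rightarrow> 'v ambient set"
  where "tangent_space score = closure (range (push score))"

definition is_efficient_influence ::
  "('t \<Rightarrow> real) \<Rightarrow> ('t \<Rightarrow> 'v::real_semi_inner) \<Rightarrow> 'v ambient \<Rightarrow> bool"
  where "is_efficient_influence d\<beta> score D \<longleftrightarrow>
    D \<in> tangent_space score \<and> (\<forall>\<phi>. d\<beta> \<phi> = D \<bullet> push score \<phi>)"

definition has_efficient_influence ::
  "('t \<Rightarrow> real) \<Rightarrow> ('t \<Rightarrow> 'v::real_semi_inner) \<Rightarrow> bool"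
  where "has_efficient_influence d\<beta> score \<longleftrightarrow> (\<exists>!D. is_efficient_influence d\<beta> score D)"

definition efficient_influence ::
  "('t \<Rightarrow> real) \<Rightarrow> ('t \<Rightarrow> 'v::real_semi_inner) \<Rightarrow> 'v ambient"
  where "efficient_influence d\<beta> score = (THE D. is_efficient_influence d\<beta> score D)"

lemma is_efficient_influence_unique:
  assumes D: "is_efficient_influence d\<beta> score D" and E: "is_efficient_influence d\<beta> score E"
  shows "D = E"
proof -
  have "closure (range (push score)) \<subseteq> {x. (D - E) \<bullet> x = 0}"
  proof (rule closure_minimal)
    show "range (push score) \<subseteq> {x. (D - E) \<bullet> x = 0}"
      using D E by (auto simp: is_efficient_influence_def inner_diff_left)
    show "closed {x. (D - E) \<bullet> x = 0}"
      by (intro closed_Collect_eq continuous_intros)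
  qed
  then have "(D - E) \<bullet> D = 0" "(D - E) \<bullet> E = 0"
    using D E by (auto simp: is_efficient_influence_def tangent_space_def)
  then have "(D - E) \<bullet> (D - E) = 0"
    by (simp add: inner_diff_right)
  then show ?thesis by simp
qed

lemma has_efficient_influence_iff:
  "has_efficient_influence d\<beta> score \<longleftrightarrow> (\<exists>D. is_efficient_influence d\<beta> score D)"
  unfolding has_efficient_influence_def using is_efficient_influence_unique by blast

text \<open>In \<^typ>\<open>ennreal\<close> the supremum of the empty set is \<open>0\<close>.\<close>

definition efficiency_bound :: "('t \<Rightarrow> real) \<Rightarrow> ('t \<Rightarrow> 'v::real_semi_inner) \<Rightarrow> ennreal"
  where "efficiency_bound d\<beta> score =
    (if \<forall>\<phi>. push score \<phi> = 0 \<longrightarrow> d\<beta> \<phi> = 0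
     then SUP \<phi>\<in>{\<phi>. push score \<phi> \<noteq> 0}. ennreal ((d\<beta> \<phi>)\<^sup>2 / (norm (push score \<phi>))\<^sup>2)
     else \<infinity>)"

text \<open>
  \<open>F\<close> is the channel pushforward \<open>\<T>(f) \<rightarrow> \<A>(g)\<close>: bounded and linear on the range of the input
  pushforward, where it factors the output pushforward, and extended by continuity to \<open>\<T>(f)\<close>.
\<close>

definition is_channel_push ::
  "('t \<Rightarrow> 'v::real_semi_inner) \<Rightarrow> ('t \<Rightarrow> 'w::real_semi_inner) \<Rightarrow> ('v ambient \<Rightarrow> 'w ambient) \<Rightarrow> bool"
  where "is_channel_push score score_out F \<longleftrightarrow>
    bounded_linear_on (range (push score)) F \<and>
    (\<forall>\<phi>. push score_out \<phi> = F (push score \<phi>)) \<and>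
    continuous_on (tangent_space score) F"

definition channel_pull ::
  "('t \<Rightarrow> 'v::real_semi_inner) \<Rightarrow> ('v ambient \<Rightarrow> 'w::real_semi_inner ambient) \<Rightarrow>
    'w ambient \<Rightarrow> 'v ambient"
  where "channel_pull score F = adjoint_on (tangent_space score) F"

end

(*
  By Riesz and density of the range of the input pushforward, F_pull y is the input efficient
  influence of the functional y \<bullet> push score_out _.  Hence a vector y solves F_pull y = D, where D is
  the input efficient influence, iff y represents d\<beta> on the range of push score_out.  If no such y
  exists then, by Riesz, d\<beta> is not bounded by a multiple of norm (push score_out _), so the output
  bound is infinite.  Otherwise the solutions are the vectors whose projection to the output
  tangent space is the output efficient influence, which is therefore the one of minimal norm.
*)
theory Submission
  imports Defs
begin

section \<open>Riesz representation in the closure of the range of a linear map\<close>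

text \<open>
  The representing vector is the limit of a minimizing sequence of \<open>\<parallel>p \<phi>\<parallel>\<^sup>2 - 2 l \<phi>\<close>, which is a
  Cauchy sequence by the parallelogram law.
\<close>

lemma riesz_closure_range:
  fixes p :: "'t::real_vector \<Rightarrow> 'h::{real_inner,banach}" and l :: "'t \<Rightarrow> real"
  assumes p: "linear p" and l: "linear l" and bound: "\<And>\<phi>. \<bar>l \<phi>\<bar> \<le> K * norm (p \<phi>)"
  obtains D where "D \<in> closure (range p)" "\<And>\<phi>. l \<phi> = D \<bullet> p \<phi>"
proof -
  define J where "J \<phi> = (norm (p \<phi>))\<^sup>2 - 2 * l \<phi>" for \<phi>
  define m where "m = (INF \<phi>. J \<phi>)"
  \<comment> \<open>Completing the square: by \<open>bound\<close>, \<open>J \<phi>\<close> is at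
    least \<open>s^2 - 2 * K * s\<close> with \<open>s = norm (p \<phi>)\<close>.\<close>
  have "- K\<^sup>2 \<le> J \<phi>" for \<phi>
  proof -
    have "0 \<le> (norm (p \<phi>) - K)\<^sup>2" by simp
    then show ?thesis
      using bound[of \<phi>] by (simp add: J_def power2_diff algebra_simps)
  qed
  then have bdd: "bdd_below (range J)"
    by (intro bdd_belowI[of _ "- K\<^sup>2"]) auto
  have m_le: "m \<le> J \<phi>" for \<phi>
    unfolding m_def by (rule cINF_lower[OF bdd]) simp
  have "\<exists>\<phi>. J \<phi> < m + inverse (real (Suc n))" for n
    using cINF_less_iff[OF _ bdd, of "m + inverse (real (Suc n))"] by (auto simp: m_def)
  then obtain \<phi> where J_less: "J (\<phi> n) < m + inverse (real (Suc n))" for n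
    by metis
  \<comment> \<open>The value of \<open>J\<close> at the midpoint of \<open>a\<close> and
    \<open>b\<close> is at least \<open>m\<close>, which bounds \<open>norm (p a + p b)\<close> from
    below; the parallelogram law turns this into an upper bound for the difference.\<close>
  have diff_le: "(norm (p a - p b))\<^sup>2 \<le> 2 * (J a - m) + 2 * (J b - m)" for a b
  proof -
    have "p ((1/2) *\<^sub>R (a + b)) = (1/2) *\<^sub>R (p a + p b)" "l ((1/2) *\<^sub>R (a + b)) = (l a + l b) / 2"
      by (simp_all only: linear_scale[OF p] linear_scale[OF l] linear_add[OF p] linear_add[OF l])
        simp
    then have "J ((1/2) *\<^sub>R (a + b)) = (norm (p a + p b))\<^sup>2 / 4 - l a - l b"
      by (simp only: J_def norm_scaleR power_mult_distrib) (simp add: power2_eq_square add_divide_distrib)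
    with m_le[of "(1/2) *\<^sub>R (a + b)"]
    have "4 * m \<le> (norm (p a + p b))\<^sup>2 - 4 * l a - 4 * l b" by simp
    then show ?thesis
      by (simp add: J_def power2_norm_eq_inner inner_add_left inner_add_right inner_diff_left
          inner_diff_right inner_commute[of "p b" "p a"])
  qed
  have "Cauchy (\<lambda>n. p (\<phi> n))"
  proof (rule metric_CauchyI)
    fix e :: real assume "0 < e"
    \<comment> \<open>The two excesses over \<open>m\<close> enter \<open>diff_le\<close> with
      factor 2 each, so a quarter of the squared tolerance suffices for each.\<close>
    then obtain N where N: "inverse (real (Suc N)) < e\<^sup>2 / 4"
      using reals_Archimedean[of "e\<^sup>2 / 4"] by auto
    have small: "J (\<phi> n) - m < e\<^sup>2 / 4" if "N \<le> n" for n
    proof -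
      have "inverse (real (Suc n)) \<le> inverse (real (Suc N))"
        using that by (intro le_imp_inverse_le) auto
      then show ?thesis using J_less[of n] N by linarith
    qed
    show "\<exists>M. \<forall>a\<ge>M. \<forall>b\<ge>M. dist (p (\<phi> a)) (p (\<phi> b)) < e"
    proof (intro exI allI impI)
      fix a b assume ab: "N \<le> a" "N \<le> b"
      have "(norm (p (\<phi> a) - p (\<phi> b)))\<^sup>2 \<le> 2 * (J (\<phi> a) - m) + 2 * (J (\<phi> b) - m)"
        by (rule diff_le)
      also have "\<dots> < e\<^sup>2"
        using small[OF ab(1)] small[OF ab(2)] by (simp add: field_simps)
      finally show "dist (p (\<phi> a)) (p (\<phi> b)) < e"
        using \<open>0 < e\<close> by (simp add: dist_norm power_less_imp_less_base)
    qed
  qed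
  then obtain D where D: "(\<lambda>n. p (\<phi> n)) \<longlonglongrightarrow> D"
    by (auto simp: Cauchy_convergent_iff convergent_def)
  have J_lim: "(\<lambda>n. J (\<phi> n)) \<longlonglongrightarrow> m"
  proof (rule tendsto_sandwich[OF _ _ tendsto_const])
    show "\<forall>\<^sub>F n in sequentially. m \<le> J (\<phi> n)"
      by (simp add: m_le)
    show "\<forall>\<^sub>F n in sequentially. J (\<phi> n) \<le> m + inverse (real (Suc n))"
      by (intro always_eventually allI less_imp_le J_less)
    show "(\<lambda>n. m + inverse (real (Suc n))) \<longlonglongrightarrow> m"
      using LIMSEQ_inverse_real_of_nat_add[of m] by simp
  qed
  show ?thesis
  proof
    show "D \<in> closure (range p)"
      by (rule limit_in_closure[OF _ D]) simp
    fix \<psi>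
    define c where "c = D \<bullet> p \<psi> - l \<psi>"
    \<comment> \<open>First variation at the minimum. \<open>D\<close> need not be a value of
      \<open>p\<close>, so the perturbation is applied to \<open>\<phi> n\<close> and the limit is
      taken afterwards.\<close>
    have variation: "0 \<le> 2 * t * c + t\<^sup>2 * (norm (p \<psi>))\<^sup>2" for t
    proof -
      have "J (\<phi> n + t *\<^sub>R \<psi>)
          = J (\<phi> n) + 2 * t * (p (\<phi> n) \<bullet> p \<psi> - l \<psi>) + t\<^sup>2 * (norm (p \<psi>))\<^sup>2" for n
        by (simp add: J_def linear_add[OF p] linear_add[OF l] linear_scale[OF p]
            linear_scale[OF l] power2_norm_eq_inner inner_add_left inner_add_right
            inner_commute[of "p \<psi>" "p (\<phi> n)"])
          (simp add: algebra_simps power2_eq_square)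
      then have "m \<le> J (\<phi> n) + 2 * t * (p (\<phi> n) \<bullet> p \<psi> - l \<psi>) + t\<^sup>2 * (norm (p \<psi>))\<^sup>2" for n
        by (metis m_le)
      moreover have "(\<lambda>n. J (\<phi> n) + 2 * t * (p (\<phi> n) \<bullet> p \<psi> - l \<psi>) + t\<^sup>2 * (norm (p \<psi>))\<^sup>2)
          \<longlonglongrightarrow> m + 2 * t * c + t\<^sup>2 * (norm (p \<psi>))\<^sup>2"
        unfolding c_def by (intro tendsto_intros J_lim D)
      ultimately have "m \<le> m + 2 * t * c + t\<^sup>2 * (norm (p \<psi>))\<^sup>2"
        by (intro LIMSEQ_le_const) auto
      then show ?thesis by simp
    qed
    have "c = 0"
    proof (rule ccontr)
      assume "c \<noteq> 0"
      \<comment> \<open>The choice \<open>t = - c / q\<close> makes the quadratic in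
        \<open>variation\<close> at most \<open>- c^2 / q\<close>; the added 1 keeps
        \<open>q\<close> positive even when \<open>p \<psi> = 0\<close>.\<close>
      define q where "q = (norm (p \<psi>))\<^sup>2 + 1"
      have "0 < q" by (simp add: q_def add_nonneg_pos)
      have "0 \<le> 2 * (- c / q) * c + (- c / q)\<^sup>2 * (norm (p \<psi>))\<^sup>2"
        by (rule variation)
      also have "\<dots> \<le> 2 * (- c / q) * c + (- c / q)\<^sup>2 * q"
        by (intro add_left_mono mult_left_mono) (auto simp: q_def)
      also have "\<dots> = - (c\<^sup>2 / q)"
        using \<open>0 < q\<close> by (simp add: field_simps power2_eq_square)
      also have "\<dots> < 0"
        using \<open>0 < q\<close> \<open>c \<noteq> 0\<close> by simp
      finally show False by simp
    qed
    then show "l \<psi> = D \<bullet> p \<psi>" by (simp add: c_def)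
  qed
qed

section \<open>Efficient influences and the value of the efficiency bound\<close>

lemma linear_push: "linear score \<Longrightarrow> linear (push score)"
  by (rule linearI)
    (simp_all add: push_def linear_add linear_scale linear_null_class linear_to_completion)

lemma efficient_influence_eqI:
  "is_efficient_influence d\<beta> score D \<Longrightarrow> efficient_influence d\<beta> score = D"
  unfolding efficient_influence_def using is_efficient_influence_unique by blast

lemma ex_is_efficient_influence:
  assumes "linear score" "linear d\<beta>" "\<And>\<phi>. \<bar>d\<beta> \<phi>\<bar> \<le> K * norm (push score \<phi>)"
  shows "\<exists>D. is_efficient_influence d\<beta> score D"
  using riesz_closure_range[OF linear_push[OF assms(1)] assms(2,3)]
  unfolding is_efficient_influence_def tangent_space_def by metis

text \<open>A finite bound excludes the default \<open>\<infinity>\<close>, so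
  \<open>d\<beta>\<close> vanishes on the kernel. The product form therefore covers the kernel too,
  and it is a closed condition.\<close>

lemma power2_le_efficiency_bound:
  assumes bnd: "efficiency_bound d\<beta> score = ennreal B" and "0 \<le> B"
  shows "(d\<beta> \<phi>)\<^sup>2 \<le> B * (norm (push score \<phi>))\<^sup>2"
proof -
  have ker: "\<forall>\<phi>. push score \<phi> = 0 \<longrightarrow> d\<beta> \<phi> = 0"
    using bnd by (auto simp: efficiency_bound_def split: if_splits)
  show ?thesis
  proof (cases "push score \<phi> = 0")
    case True
    then show ?thesis using ker by simp
  next
    case False
    have "ennreal ((d\<beta> \<phi>)\<^sup>2 / (norm (push score \<phi>))\<^sup>2) \<le> efficiency_bound d\<beta> score"
      using ker False by (auto simp: efficiency_bound_def intro: SUP_upper)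
    then have "(d\<beta> \<phi>)\<^sup>2 / (norm (push score \<phi>))\<^sup>2 \<le> B"
      using \<open>0 \<le> B\<close> by (simp add: bnd)
    then show ?thesis using False by (simp add: field_simps)
  qed
qed

text \<open>Cauchy-Schwarz gives the upper estimate. Since \<open>D\<close> is only a limit of
  pushed vectors, the supremum need not be attained; for the lower estimate the inequality with
  constant \<open>B\<close> is extended to the closure and evaluated at \<open>D\<close>
  itself.\<close>

lemma efficiency_bound_eq:
  assumes D: "is_efficient_influence d\<beta> score D"
  shows "efficiency_bound d\<beta> score = ennreal ((norm D)\<^sup>2)"
proof (rule antisym)
  have d\<beta>: "d\<beta> \<phi> = D \<bullet> push score \<phi>" for \<phi>
    using D by (simp add: is_efficient_influence_def)
  have "(d\<beta> \<phi>)\<^sup>2 / (norm (push score \<phi>))\<^sup>2 \<le> (norm D)\<^sup>2" if "push score \<phi> \<noteq> 0" for \<phi>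
    using Cauchy_Schwarz_ineq[of D "push score \<phi>"] that
    by (simp add: d\<beta> power2_norm_eq_inner divide_le_eq)
  then show le: "efficiency_bound d\<beta> score \<le> ennreal ((norm D)\<^sup>2)"
    by (auto simp: efficiency_bound_def d\<beta> intro!: SUP_least ennreal_leI)
  have "efficiency_bound d\<beta> score \<noteq> \<infinity>"
    using le by (auto simp: top_unique)
  then obtain B where B: "0 \<le> B" "efficiency_bound d\<beta> score = ennreal B"
    by (cases "efficiency_bound d\<beta> score") auto
  have "closure (range (push score)) \<subseteq> {x. (D \<bullet> x)\<^sup>2 \<le> B * (norm x)\<^sup>2}"
  proof (rule closure_minimal)
    show "range (push score) \<subseteq> {x. (D \<bullet> x)\<^sup>2 \<le> B * (norm x)\<^sup>2}"
      using power2_le_efficiency_bound[OF B(2,1)] by (auto simp: d\<beta>)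
    show "closed {x. (D \<bullet> x)\<^sup>2 \<le> B * (norm x)\<^sup>2}"
      by (intro closed_Collect_le continuous_intros)
  qed
  then have "(D \<bullet> D)\<^sup>2 \<le> B * (norm D)\<^sup>2"
    using D by (auto simp: is_efficient_influence_def tangent_space_def)
  then have "(norm D)\<^sup>2 * (norm D)\<^sup>2 \<le> B * (norm D)\<^sup>2"
    by (simp only: power2_norm_eq_inner power2_eq_square[of "D \<bullet> D"])
  then have "(norm D)\<^sup>2 \<le> B"
    using \<open>0 \<le> B\<close> mult_right_le_imp_le[of "(norm D)\<^sup>2" "(norm D)\<^sup>2" B]
    by (cases "D = 0") simp_all
  then show "ennreal ((norm D)\<^sup>2) \<le> efficiency_bound d\<beta> score"
    by (simp add: B(2) ennreal_leI)
qed

section \<open>The channel pullback as an efficient influence\<close>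

text \<open>Boundedness of \<open>F\<close> on the range of the input pushforward makes this
  functional bounded by the input norm, so Riesz applies.\<close>

lemma ex_is_efficient_influence_inner_push:
  assumes "linear score" and "linear score_out" and push: "is_channel_push score score_out F"
  shows "\<exists>D. is_efficient_influence (\<lambda>\<phi>. y \<bullet> push score_out \<phi>) score D"
proof -
  obtain K where K: "norm (push score_out \<phi>) \<le> K * norm (push score \<phi>)" for \<phi>
    using push by (auto simp: is_channel_push_def bounded_linear_on_def)
  show ?thesis
  proof (rule ex_is_efficient_influence[OF assms(1)])
    show "linear (\<lambda>\<phi>. y \<bullet> push score_out \<phi>)"
      using linear_push[OF assms(2)]
      by (intro linearI) (simp_all add: linear_add linear_scale inner_add_right)
    fix \<phi>
    have "\<bar>y \<bullet> push score_out \<phi>\<bar> \<le> norm y * norm (push score_out \<phi>)"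
      by (rule Cauchy_Schwarz_ineq2)
    also have "\<dots> \<le> norm y * (K * norm (push score \<phi>))"
      by (intro mult_left_mono K) simp
    finally show "\<bar>y \<bullet> push score_out \<phi>\<bar> \<le> (norm y * K) * norm (push score \<phi>)"
      by simp
  qed
qed

text \<open>Both sides are definite descriptions with equivalent conditions: by continuity of
  \<open>F\<close>, the adjoint identity on the tangent space follows from its instances on the
  dense range.\<close>

lemma channel_pull_eq_efficient_influence:
  assumes push: "is_channel_push score score_out F"
  shows "channel_pull score F y = efficient_influence (\<lambda>\<phi>. y \<bullet> push score_out \<phi>) score"
proof -
  have "(\<forall>u\<in>tangent_space score. x \<bullet> u = y \<bullet> F u) \<longleftrightarrow>
      (\<forall>\<phi>. y \<bullet> push score_out \<phi> = x \<bullet> push score \<phi>)" (is "?L \<longleftrightarrow> ?R") for x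
  proof
    assume ?L
    moreover have "push score \<phi> \<in> tangent_space score" for \<phi>
      unfolding tangent_space_def by (rule subsetD[OF closure_subset]) simp
    ultimately show ?R using push by (simp add: is_channel_push_def)
  next
    assume R: ?R
    show ?L
    proof
      fix u assume u: "u \<in> tangent_space score"
      have "continuous_on (closure (range (push score))) (\<lambda>u. x \<bullet> u - y \<bullet> F u)"
        using push unfolding is_channel_push_def tangent_space_def
        by (intro continuous_intros) simp
      moreover have "x \<bullet> v - y \<bullet> F v = 0" if v: "v \<in> range (push score)" for v
      proof -
        obtain \<phi> where "v = push score \<phi>" using v by blast
        moreover from this have "F v = push score_out \<phi>"
          using push by (simp add: is_channel_push_def)
        ultimately show ?thesis using R by simp
      qed
      ultimately have "x \<bullet> u - y \<bullet> F u = 0"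
        using u unfolding tangent_space_def by (rule continuous_constant_on_closure)
      then show "x \<bullet> u = y \<bullet> F u" by simp
    qed
  qed
  then show ?thesis
    unfolding channel_pull_def adjoint_on_def efficient_influence_def is_efficient_influence_def
    by simp
qed

text \<open>Existence ensures that the description defining the adjoint has the intended
  value.\<close>

lemma is_efficient_influence_channel_pull:
  assumes "linear score" and "linear score_out" and push: "is_channel_push score score_out F"
  shows "is_efficient_influence (\<lambda>\<phi>. y \<bullet> push score_out \<phi>) score (channel_pull score F y)"
  using ex_is_efficient_influence_inner_push[OF assms]
  by (metis channel_pull_eq_efficient_influence[OF push] efficient_influence_eqI)

text \<open>An efficient influence determines its functional and is determined by it. Thus solving
  the pullback equation amounts to representing \<open>d\<beta>\<close> on the output side.\<close>

lemma channel_pull_eq_iff: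
  assumes "linear score" and "linear score_out" and push: "is_channel_push score score_out F"
    and D: "is_efficient_influence d\<beta> score D"
  shows "channel_pull score F y = D \<longleftrightarrow> (\<forall>\<phi>. d\<beta> \<phi> = y \<bullet> push score_out \<phi>)"
proof
  note pull = is_efficient_influence_channel_pull[OF assms(1-3), of y]
  show "\<forall>\<phi>. d\<beta> \<phi> = y \<bullet> push score_out \<phi>" if "channel_pull score F y = D"
    using pull D that by (simp add: is_efficient_influence_def)
  show "channel_pull score F y = D" if "\<forall>\<phi>. d\<beta> \<phi> = y \<bullet> push score_out \<phi>"
  proof -
    have "d\<beta> = (\<lambda>\<phi>. y \<bullet> push score_out \<phi>)" using that by auto
    then show ?thesis using pull D is_efficient_influence_unique by blast
  qed
qed

section \<open>Minimum-norm solutions and the pseudo-inverse\<close>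

text \<open>\<open>y - E\<close> is orthogonal to the pushed vectors, hence to their closure, which
  contains \<open>E\<close>.\<close>

lemma efficient_influence_pythagoras:
  assumes E: "is_efficient_influence d\<beta> score E" and y: "\<And>\<phi>. d\<beta> \<phi> = y \<bullet> push score \<phi>"
  shows "(norm y)\<^sup>2 = (norm E)\<^sup>2 + (norm (y - E))\<^sup>2"
proof -
  have "closure (range (push score)) \<subseteq> {x. (y - E) \<bullet> x = 0}"
  proof (rule closure_minimal)
    show "range (push score) \<subseteq> {x. (y - E) \<bullet> x = 0}"
      using E y by (auto simp: is_efficient_influence_def inner_diff_left)
    show "closed {x. (y - E) \<bullet> x = 0}"
      by (intro closed_Collect_eq continuous_intros)
  qed
  then have "(y - E) \<bullet> E = 0"
    using E by (auto simp: is_efficient_influence_def tangent_space_def)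
  then show ?thesis
    by (simp add: power2_norm_eq_inner inner_diff_left inner_diff_right inner_commute[of E y])
qed

text \<open>Here \<open>z\<close> lies in the range of \<open>T\<close>, so \<open>z = z + 0\<close>
  is an admissible decomposition, and it is the only one.\<close>

lemma pseudo_inverse_eqI:
  assumes "0 \<in> H\<^sub>2"
    and min: "is_min_norm_solution UNIV T z x"
    and unique: "\<And>x'. is_min_norm_solution UNIV T z x' \<Longrightarrow> x' = x"
  shows "pseudo_inverse UNIV H\<^sub>2 T z = x"
  unfolding pseudo_inverse_def
proof (rule the_equality)
  have "z = T x" using min by (simp add: is_min_norm_solution_def)
  then show "\<exists>y\<in>range T. \<exists>w\<in>H\<^sub>2 \<inter> (range T)\<^sup>\<bottom>. z = y + w \<and> is_min_norm_solution UNIV T y x"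
    using min \<open>0 \<in> H\<^sub>2\<close>
    by (intro bexI[of _ z] bexI[of _ 0]) (auto simp: orthogonal_comp_def orthogonal_def)
  fix x'
  assume "\<exists>y\<in>range T. \<exists>w\<in>H\<^sub>2 \<inter> (range T)\<^sup>\<bottom>. z = y + w \<and> is_min_norm_solution UNIV T y x'"
  then obtain b w where w: "w \<in> (range T)\<^sup>\<bottom>" "z = T b + w"
    and x': "is_min_norm_solution UNIV T (T b) x'"
    by auto
  have "w \<bullet> T x = 0" "w \<bullet> T b = 0"
    using w(1) by (auto simp: orthogonal_comp_def orthogonal_def inner_commute)
  moreover have "w = T x - T b"
    using w(2) \<open>z = T x\<close> by simp
  ultimately have "w \<bullet> w = 0"
    by (metis inner_diff_right diff_zero)
  then show "x' = x" using x' w(2) unique by simp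
qed

section \<open>The output efficient influence and bound\<close>

theorem mainTheorem2:
  fixes d\<beta> :: "'t::real_vector \<Rightarrow> real"
    and score :: "'t \<Rightarrow> 'v::real_semi_inner"
    and score_out :: "'t \<Rightarrow> 'w::real_semi_inner"
    and F_push :: "'v ambient \<Rightarrow> 'w ambient"
    and F_pull :: "'w ambient \<Rightarrow> 'v ambient"
  assumes "linear d\<beta>" and "linear score" and "linear score_out"
    and "is_channel_push score score_out F_push"
    and F_pull: "F_pull = channel_pull score F_push"
    and "has_efficient_influence d\<beta> score"
  shows "(efficient_influence d\<beta> score \<notin> range F_pull \<longrightarrow>
        efficiency_bound d\<beta> score_out = \<infinity>) \<and>
    (efficient_influence d\<beta> score \<in> range F_pull \<longrightarrow>
        has_efficient_influence d\<beta> score_out \<and>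
        efficient_influence d\<beta> score_out =
          pseudo_inverse UNIV (tangent_space score) F_pull (efficient_influence d\<beta> score) \<and>
        efficiency_bound d\<beta> score_out =
          ennreal ((norm (efficient_influence d\<beta> score_out))\<^sup>2) \<and>
        efficiency_bound d\<beta> score_out =
          ennreal ((norm (pseudo_inverse UNIV (tangent_space score) F_pull
            (efficient_influence d\<beta> score)))\<^sup>2))"
proof -
  note channel = assms(2-4)
  define D where "D = efficient_influence d\<beta> score"
  have D: "is_efficient_influence d\<beta> score D"
    using assms(6) unfolding D_def has_efficient_influence_iff
    by (metis efficient_influence_eqI)
  have pull_iff: "F_pull y = D \<longleftrightarrow> (\<forall>\<phi>. d\<beta> \<phi> = y \<bullet> push score_out \<phi>)" for y
    unfolding F_pull by (rule channel_pull_eq_iff[OF channel D])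
  \<comment> \<open>Contrapositive of the first claim: a finite bound \<open>B\<close> dominates
    \<open>d\<beta>\<close> with constant \<open>sqrt B\<close>, and Riesz on the output side yields
    a preimage of \<open>D\<close>.\<close>
  have "D \<in> range F_pull" if finite: "efficiency_bound d\<beta> score_out \<noteq> \<infinity>"
  proof -
    obtain B where B: "0 \<le> B" "efficiency_bound d\<beta> score_out = ennreal B"
      using finite by (cases "efficiency_bound d\<beta> score_out") auto
    have "\<bar>d\<beta> \<phi>\<bar> \<le> sqrt B * norm (push score_out \<phi>)" for \<phi>
      by (rule power2_le_imp_le)
        (use power2_le_efficiency_bound[OF B(2,1), of \<phi>] B(1) in \<open>simp_all add: power_mult_distrib\<close>)
    then obtain E where "is_efficient_influence d\<beta> score_out E"
      using ex_is_efficient_influence[OF assms(3,1)] by blast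
    then have "F_pull E = D"
      by (simp add: pull_iff is_efficient_influence_def)
    then show ?thesis by blast
  qed
  moreover have "has_efficient_influence d\<beta> score_out \<and>
      efficient_influence d\<beta> score_out = pseudo_inverse UNIV (tangent_space score) F_pull D \<and>
      efficiency_bound d\<beta> score_out = ennreal ((norm (efficient_influence d\<beta> score_out))\<^sup>2)"
    if range: "D \<in> range F_pull"
  proof -
    \<comment> \<open>This preimage may lie outside the output tangent space; it serves only to
      bound \<open>d\<beta>\<close>, and Riesz then supplies the representative \<open>E\<close>
      inside that space.\<close>
    obtain y where y: "\<And>\<phi>. d\<beta> \<phi> = y \<bullet> push score_out \<phi>"
      using range pull_iff by (metis imageE)
    have "\<bar>d\<beta> \<phi>\<bar> \<le> norm y * norm (push score_out \<phi>)" for \<phi>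
      unfolding y by (rule Cauchy_Schwarz_ineq2)
    then obtain E where E: "is_efficient_influence d\<beta> score_out E"
      using ex_is_efficient_influence[OF assms(3,1)] by blast
    have pull_E: "F_pull E = D"
      using E by (simp add: pull_iff is_efficient_influence_def)
    have pythagoras: "(norm x)\<^sup>2 = (norm E)\<^sup>2 + (norm (x - E))\<^sup>2" if "F_pull x = D" for x
      using efficient_influence_pythagoras[OF E] that pull_iff by blast
    \<comment> \<open>By \<open>pythagoras\<close>, \<open>E\<close> has least norm among the
      solutions, and a solution with no larger norm is at distance 0 from it.\<close>
    have "pseudo_inverse UNIV (tangent_space score) F_pull D = E"
    proof (rule pseudo_inverse_eqI)
      show "0 \<in> tangent_space score"
        unfolding tangent_space_def
        by (metis linear_0[OF linear_push[OF assms(2)]] closure_subset rangeI subsetD)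
      have "norm E \<le> norm x" if "F_pull x = D" for x
        by (rule power2_le_imp_le) (use pythagoras[OF that] in auto)
      then show "is_min_norm_solution UNIV F_pull D E"
        by (simp add: is_min_norm_solution_def pull_E)
      fix x assume "is_min_norm_solution UNIV F_pull D x"
      then have "F_pull x = D" "norm x \<le> norm E"
        by (auto simp: is_min_norm_solution_def pull_E)
      then have "(norm (x - E))\<^sup>2 \<le> 0"
        using pythagoras[of x] power_mono[of "norm x" "norm E" 2] by simp
      then show "x = E" by simp
    qed
    then show ?thesis
      using E efficiency_bound_eq[OF E] efficient_influence_eqI[OF E]
      by (auto simp: has_efficient_influence_iff)
  qed
  ultimately show ?thesis
    unfolding D_def by metis
qed

end
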